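(* 1. Modus ponens is independent of the axioms of preconditionals plus weak monotonicity: there exist a bounded lattice $L$ and a preconditional $\to$ on $L$ satisfying weak monotonicity but not modus ponens. 2. Weak monotonicity is independent of the axioms of preconditionals plus modus ponens: there exist a bounded lattice $L$ and a preconditional $\to$ on $L$ satisfying modus ponens but not weak monotonicity.
   Context: A preconditional on a bounded lattice $L$ is a binary operation $\to$ on $L$ such that for all $a,b,c\in L$: (1) $1\to a\leq a$; (2) $a\wedge b\leq a\to b$; (3) $a\to b\leq a\to(a\wedge b)$; (4) $a\to(b\wedge c)\leq a\to b$; (5) $a\to((a\wedge b)\to c)\leq (a\wedge b)\to c$. Modus ponens: $a\wedge(a\to b)\leq b$ for all $a,b\in L$. Weak monotonicity: $b\leq a\to b$ for all $a,b\in L$. *)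

theory Defs
  imports "HOL-Algebra.Lattice"
begin

locale preconditional = bounded_lattice L for L (structure) +
  fixes imp :: "'a \<Rightarrow> 'a \<Rightarrow> 'a" (infixr \<open>\<leadsto>\<close> 60)
  assumes imp_closed:
      "\<lbrakk>a \<in> carrier L; b \<in> carrier L\<rbrakk> \<Longrightarrow> (a \<leadsto> b) \<in> carrier L"
    and top_imp_le:
      "a \<in> carrier L \<Longrightarrow> (\<top> \<leadsto> a) \<sqsubseteq> a"
    and meet_le_imp:
      "\<lbrakk>a \<in> carrier L; b \<in> carrier L\<rbrakk> \<Longrightarrow> (a \<sqinter> b) \<sqsubseteq> (a \<leadsto> b)"
    and imp_le_imp_meet:
      "\<lbrakk>a \<in> carrier L; b \<in> carrier L\<rbrakk> \<Longrightarrow> (a \<leadsto> b) \<sqsubseteq> (a \<leadsto> (a \<sqinter> b))"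
    and imp_meet_le_imp:
      "\<lbrakk>a \<in> carrier L; b \<in> carrier L; c \<in> carrier L\<rbrakk>
        \<Longrightarrow> (a \<leadsto> (b \<sqinter> c)) \<sqsubseteq> (a \<leadsto> b)"
    and imp_meet_imp_le:
      "\<lbrakk>a \<in> carrier L; b \<in> carrier L; c \<in> carrier L\<rbrakk>
        \<Longrightarrow> (a \<leadsto> ((a \<sqinter> b) \<leadsto> c)) \<sqsubseteq> ((a \<sqinter> b) \<leadsto> c)"

definition modus_ponens :: "('a, 'b) gorder_scheme \<Rightarrow> ('a \<Rightarrow> 'a \<Rightarrow> 'a) \<Rightarrow> bool" where
  "modus_ponens L imp \<longleftrightarrow>
    (\<forall>a\<in>carrier L. \<forall>b\<in>carrier L. (a \<sqinter>\<^bsub>L\<^esub> imp a b) \<sqsubseteq>\<^bsub>L\<^esub> b)"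

definition weak_monotonicity :: "('a, 'b) gorder_scheme \<Rightarrow> ('a \<Rightarrow> 'a \<Rightarrow> 'a) \<Rightarrow> bool" where
  "weak_monotonicity L imp \<longleftrightarrow>
    (\<forall>a\<in>carrier L. \<forall>b\<in>carrier L. b \<sqsubseteq>\<^bsub>L\<^esub> imp a b)"

end

(* On a chain with top n, sending (a, b) to b if a = n and to n otherwise is a
   weakly monotone preconditional; it violates modus ponens at (1, 0) when n > 1.
   On any nontrivial bounded lattice, meet is a preconditional with modus ponens,
   but it is not weakly monotone since 1 is not below 0 \<sqinter> 1. *)
theory Submission
  imports Defs
begin

definition nat_chain :: "nat \<Rightarrow> nat gorder" where
  "nat_chain n = \<lparr>carrier = {..n}, eq = (=), le = (\<le>)\<rparr>"

lemma nat_chain_simps [simp]: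
  "carrier (nat_chain n) = {..n}"
  "x .=\<^bsub>nat_chain n\<^esub> y \<longleftrightarrow> x = y"
  "x \<sqsubseteq>\<^bsub>nat_chain n\<^esub> y \<longleftrightarrow> x \<le> y"
  by (simp_all add: nat_chain_def)

text \<open>Linearity supplies binary meets and joins, so only the bounds 0 and \<open>n\<close>
  remain to be exhibited.\<close>

lemma nat_chain_bounded_lattice: "bounded_lattice (nat_chain n)"
proof -
  interpret total_order "nat_chain n"
    by unfold_locales (auto simp: fun_eq_iff)
  show ?thesis
    by unfold_locales (auto intro: exI[of _ 0] exI[of _ n] simp: least_def greatest_def)
qed

lemma nat_chain_top [simp]: "\<top>\<^bsub>nat_chain n\<^esub> = n"
proof -
  interpret bounded_lattice "nat_chain n" by (rule nat_chain_bounded_lattice)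
  show ?thesis using top_closed top_higher[of n] by simp
qed

lemma nat_chain_meet [simp]:
  assumes "x \<le> n" "y \<le> n"
  shows "x \<sqinter>\<^bsub>nat_chain n\<^esub> y = min x y"
proof -
  interpret bounded_lattice "nat_chain n" by (rule nat_chain_bounded_lattice)
  show ?thesis
    using assms meet_left[of x y] meet_right[of x y] meet_le[of "min x y" x y]
    by (simp add: antisym)
qed

text \<open>Below the top the value is \<open>n\<close>, so an upper bound of this form is trivial.
  In axiom (5), if \<open>a\<close> meets \<open>b\<close> in \<open>n\<close>, then
  \<open>a = n\<close> and both sides equal \<open>c\<close>; otherwise the right side is
  \<open>n\<close>.\<close>

lemma preconditional_drastic:
  "preconditional (nat_chain n) (\<lambda>a b. if a = n then b else n)"
proof -
  interpret bounded_lattice "nat_chain n" by (rule nat_chain_bounded_lattice)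
  show ?thesis by unfold_locales (auto simp: min_def)
qed

text \<open>Axioms (3) and (5) reduce to idempotence and associativity of meet, the others to its
  being a lower bound.\<close>

lemma preconditional_min: "preconditional (nat_chain n) min"
proof -
  interpret bounded_lattice "nat_chain n" by (rule nat_chain_bounded_lattice)
  show ?thesis by unfold_locales auto
qed

theorem fact2:
  shows "(\<exists>(L :: nat gorder) imp.
            bounded_lattice L \<and> preconditional L imp \<and>
            weak_monotonicity L imp \<and> \<not> modus_ponens L imp)
       \<and> (\<exists>(L :: nat gorder) imp.
            bounded_lattice L \<and> preconditional L imp \<and>
            modus_ponens L imp \<and> \<not> weak_monotonicity L imp)"
proof
  \<comment> \<open>Three elements are needed: an antecedent that is neither top nor bottom. In the
    two-element chain this operation satisfies modus ponens.\<close>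
  let ?imp = "\<lambda>(a::nat) (b::nat). if a = 2 then b else 2"
  have "weak_monotonicity (nat_chain 2) ?imp"
    by (simp add: weak_monotonicity_def)
  moreover have "\<not> modus_ponens (nat_chain 2) ?imp"
  proof
    assume "modus_ponens (nat_chain 2) ?imp"
    from this[unfolded modus_ponens_def, THEN bspec[of _ _ 1], THEN bspec[of _ _ 0]]
    show False by simp
  qed
  ultimately show "\<exists>(L :: nat gorder) imp. bounded_lattice L \<and> preconditional L imp \<and>
      weak_monotonicity L imp \<and> \<not> modus_ponens L imp"
    using nat_chain_bounded_lattice preconditional_drastic by blast
next
  \<comment> \<open>Here two distinct elements suffice; in the one-element chain weak monotonicity
    would hold.\<close>
  have "modus_ponens (nat_chain 1) min"
    by (simp add: modus_ponens_def)
  moreover have "\<not> weak_monotonicity (nat_chain 1) min"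
    unfolding weak_monotonicity_def by (auto dest!: bspec[of _ _ 0] bspec[of _ _ 1])
  ultimately show "\<exists>(L :: nat gorder) imp. bounded_lattice L \<and> preconditional L imp \<and>
      modus_ponens L imp \<and> \<not> weak_monotonicity L imp"
    using nat_chain_bounded_lattice preconditional_min by blast
qed

end
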